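(* Let $\lambda$ be a nonzero real number and let $\alpha,n$ be nonnegative integers with $n\ge\alpha$. Then $$ \alpha!{n \brace \alpha}_{-\lambda}=\sum_{j=\alpha}^{n}(-1)^{n-j}j!{n \brace j}_{\lambda}\binom{j-1}{\alpha-1}. $$
   Context: For a real parameter $\mu$ the degenerate falling factorials are $(x)_{0,\mu}=1$ and $(x)_{n,\mu}=x(x-\mu)\cdots(x-(n-1)\mu)$ for $n\ge1$; $(x)_n=(x)_{n,1}$ is the usual falling factorial. The degenerate Stirling numbers of the second kind ${n \brace k}_{\mu}$ are defined by $(x)_{n,\mu}=\sum_{k=0}^{n}{n \brace k}_{\mu}(x)_k$ (so ${n\brace k}_{-\lambda}$ is obtained with $\mu=-\lambda$). Binomial coefficients are $\binom{x}{m}=(x)_m/m!$ for integers $m\ge0$. For $0\le\alpha\le j$, the symbol $\binom{j-1}{\alpha-1}$ is understood as $\binom{j-1}{j-\alpha}$ (this agrees with the usual value when $j\ge1$, and gives $\binom{-1}{-1}=1$). *)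

theory Defs
  imports Complex_Main
begin

definition degen_ffact :: "real \<Rightarrow> real \<Rightarrow> nat \<Rightarrow> real" where
  "degen_ffact \<mu> x n = (\<Prod>i<n. x - real i * \<mu>)"

text \<open>
  The coefficients are pinned down by their defining expansion, read as an identity for all
  real \<open>x\<close>, and are extended by zero to \<open>k > n\<close>.
  That the description is proper is shown in \<open>degen_stirling2_ex1\<close> below.
\<close>

definition degen_stirling2 :: "real \<Rightarrow> nat \<Rightarrow> nat \<Rightarrow> real" where
  "degen_stirling2 \<mu> n =
     (THE S. (\<forall>x. degen_ffact \<mu> x n = (\<Sum>k=0..n. S k * degen_ffact 1 x k)) \<and> (\<forall>k>n. S k = 0))"

lemma degen_ffact_0: "degen_ffact \<mu> x 0 = 1"
  by (simp add: degen_ffact_def)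

lemma degen_ffact_Suc: "degen_ffact \<mu> x (Suc n) = degen_ffact \<mu> x n * (x - real n * \<mu>)"
  by (simp add: degen_ffact_def)

lemma degen_ffact_1_eq_0: "m < k \<Longrightarrow> degen_ffact 1 (real m) k = 0"
  unfolding degen_ffact_def by (rule prod_zero) auto

lemma degen_ffact_1_neq_0: "degen_ffact 1 (real m) m \<noteq> 0"
  by (auto simp: degen_ffact_def)

lemma degen_ffact_1_coeffs_0:
  assumes "\<And>x. (\<Sum>k=0..n. d k * degen_ffact 1 x k) = 0" and "m \<le> n"
  shows "d m = 0"
  using \<open>m \<le> n\<close>
proof (induction m rule: less_induct)
  case (less m)
  have "d k * degen_ffact 1 (real m) k = 0" if "k \<in> {0..n} - {m}" for k
  proof (cases "k < m")
    case True
    then show ?thesis using less by simp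
  next
    case False
    then have "m < k" using that by auto
    then show ?thesis by (simp add: degen_ffact_1_eq_0)
  qed
  then have "(\<Sum>k\<in>{m}. d k * degen_ffact 1 (real m) k) = (\<Sum>k=0..n. d k * degen_ffact 1 (real m) k)"
    using less.prems by (intro sum.mono_neutral_left) auto
  then show ?case
    using assms(1)[of "real m"] degen_ffact_1_neq_0[of m] by simp
qed

lemma degen_stirling2_ex:
  "\<exists>S. (\<forall>x. degen_ffact \<mu> x n = (\<Sum>k=0..n. S k * degen_ffact 1 x k)) \<and> (\<forall>k>n. S k = 0)"
proof (induction n)
  case 0
  show ?case
    by (rule exI[of _ "\<lambda>k. if k = 0 then 1 else 0"]) (simp add: degen_ffact_0)
next
  case (Suc n)
  then obtain S where S: "\<And>x. degen_ffact \<mu> x n = (\<Sum>k=0..n. S k * degen_ffact 1 x k)"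
    and S0: "\<And>k. k > n \<Longrightarrow> S k = 0" by blast
  define T where "T k = (if k = 0 then 0 else S (k - 1)) + (real k - real n * \<mu>) * S k" for k
  have "degen_ffact \<mu> x (Suc n) = (\<Sum>k=0..Suc n. T k * degen_ffact 1 x k)" for x
  proof -
    let ?f = "\<lambda>k. degen_ffact 1 x k"
    have shift: "(\<Sum>k=0..Suc n. (if k = 0 then 0 else S (k - 1)) * ?f k) = (\<Sum>k=0..n. S k * ?f (Suc k))"
      by (subst sum.atLeast0_atMost_Suc_shift) (simp add: comp_def)
    have last: "(\<Sum>k=0..Suc n. (real k - real n * \<mu>) * S k * ?f k)
        = (\<Sum>k=0..n. (real k - real n * \<mu>) * S k * ?f k)"
      by (simp add: S0)
    have "(\<Sum>k=0..Suc n. T k * ?f k) =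
       (\<Sum>k=0..Suc n. (if k = 0 then 0 else S (k - 1)) * ?f k)
       + (\<Sum>k=0..Suc n. (real k - real n * \<mu>) * S k * ?f k)"
      unfolding sum.distrib[symmetric] by (rule sum.cong) (auto simp: T_def distrib_right)
    also have "\<dots> = (\<Sum>k=0..n. S k * ?f (Suc k) + (real k - real n * \<mu>) * S k * ?f k)"
      unfolding shift last sum.distrib ..
    also have "\<dots> = (\<Sum>k=0..n. S k * ?f k * (x - real n * \<mu>))"
      by (rule sum.cong) (auto simp: degen_ffact_Suc algebra_simps)
    also have "\<dots> = degen_ffact \<mu> x (Suc n)"
      by (simp add: degen_ffact_Suc S sum_distrib_right)
    finally show ?thesis ..
  qed
  moreover have "T k = 0" if "k > Suc n" for k
    using that by (simp add: T_def S0)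
  ultimately show ?case by blast
qed

lemma degen_stirling2_ex1:
  "\<exists>!S. (\<forall>x. degen_ffact \<mu> x n = (\<Sum>k=0..n. S k * degen_ffact 1 x k)) \<and> (\<forall>k>n. S k = 0)"
proof (rule ex_ex1I[OF degen_stirling2_ex], elim conjE, rule ext)
  fix S T :: "nat \<Rightarrow> real" and m
  assume S: "\<forall>x. degen_ffact \<mu> x n = (\<Sum>k=0..n. S k * degen_ffact 1 x k)" "\<forall>k>n. S k = 0"
    and T: "\<forall>x. degen_ffact \<mu> x n = (\<Sum>k=0..n. T k * degen_ffact 1 x k)" "\<forall>k>n. T k = 0"
  show "S m = T m"
  proof (cases "m \<le> n")
    case True
    have "(\<Sum>k=0..n. (S k - T k) * degen_ffact 1 x k) = 0" for x
      using S(1) T(1) by (simp add: left_diff_distrib sum_subtractf)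
    from degen_ffact_1_coeffs_0[OF this True] show ?thesis by simp
  next
    case False
    then show ?thesis using S(2) T(2) by simp
  qed
qed

lemma degen_stirling2_expansion:
  "degen_ffact \<mu> x n = (\<Sum>k=0..n. degen_stirling2 \<mu> n k * degen_ffact 1 x k)"
  using theI'[OF degen_stirling2_ex1[of \<mu> n]] unfolding degen_stirling2_def by blast

lemma degen_stirling2_eq_0: "k > n \<Longrightarrow> degen_stirling2 \<mu> n k = 0"
  using theI'[OF degen_stirling2_ex1[of \<mu> n]] unfolding degen_stirling2_def by blast

lemma gchoose_eq_degen_ffact: "(x :: real) gchoose m = degen_ffact 1 x m / fact m"
  by (simp add: gbinomial_prod_rev degen_ffact_def lessThan_atLeast0)

end

theory Submission
  imports Defs "HOL-Computational_Algebra.Formal_Power_Series"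
begin

text \<open>
  Since \<open>(x)\<^sub>n\<close> with parameter \<open>- \<lambda>\<close> is \<open>(- 1)\<^sup>n\<close> times \<open>(- x)\<^sub>n\<close> with parameter \<open>\<lambda>\<close>, expand the
  latter in the ordinary falling factorials of \<open>- x\<close>. Upper negation and Vandermonde's convolution
  rewrite these in the ordinary falling factorials of \<open>x\<close>, and comparing coefficients gives the claim.
\<close>

lemma degen_ffact_uminus: "degen_ffact (- \<mu>) x n = (- 1) ^ n * degen_ffact \<mu> (- x) n"
  by (induction n) (simp_all add: degen_ffact_0 degen_ffact_Suc algebra_simps)

lemma degen_ffact_1_conv_gchoose: "degen_ffact 1 x k = fact k * (x gchoose k)"
  by (simp add: gchoose_eq_degen_ffact)

text \<open>The coefficients are the signed Lah numbers. Subtraction in \<open>real j - 1\<close> is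
  over the reals, so at \<open>j = 0\<close> the binomial is
  \<open>(- 1) gchoose 0 = 1\<close>.\<close>

lemma degen_ffact_1_uminus:
  "degen_ffact 1 (- x) j =
    (\<Sum>k=0..j. (- 1) ^ j * fact j * ((real j - 1) gchoose (j - k)) / fact k * degen_ffact 1 x k)"
proof -
  have "(- x) gchoose j = (- 1) ^ j * ((x + (real j - 1)) gchoose j)"
    by (simp add: gbinomial_minus algebra_simps)
  also have "(x + (real j - 1)) gchoose j = (\<Sum>k=0..j. (x gchoose k) * ((real j - 1) gchoose (j - k)))"
    by (simp add: gbinomial_Vandermonde)
  finally show ?thesis
    by (simp add: degen_ffact_1_conv_gchoose sum_distrib_left mult_ac)
qed

text \<open>By linear independence of the falling factorials; \<open>S\<close> may be arbitrary
  beyond \<open>n\<close>.\<close>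

lemma degen_stirling2_eqI:
  assumes "\<And>x. degen_ffact \<mu> x n = (\<Sum>k=0..n. S k * degen_ffact 1 x k)" and "m \<le> n"
  shows "degen_stirling2 \<mu> n m = S m"
proof -
  have "(\<Sum>k=0..n. (degen_stirling2 \<mu> n k - S k) * degen_ffact 1 x k) = 0" for x
    using degen_stirling2_expansion[of \<mu> x n] assms(1)[of x]
    by (simp add: left_diff_distrib sum_subtractf)
  from degen_ffact_1_coeffs_0[OF this \<open>m \<le> n\<close>] show ?thesis by simp
qed

theorem theorem2p3:
  fixes lam :: real and \<alpha> n :: nat
  assumes "lam \<noteq> 0" and "n \<ge> \<alpha>"
  shows "fact \<alpha> * degen_stirling2 (- lam) n \<alpha> =
    (\<Sum>j=\<alpha>..n. (- 1) ^ (n - j) * fact j * degen_stirling2 lam n j * ((real j - 1) gchoose (j - \<alpha>)))"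
proof -
  \<comment> \<open>\<open>c j k\<close> is what the \<open>j\<close>-th term of the expansion at
    \<open>- x\<close> contributes to the coefficient of \<open>degen_ffact 1 x k\<close>.\<close>
  define c where "c j k = (- 1) ^ (n - j) * fact j * degen_stirling2 lam n j
    * ((real j - 1) gchoose (j - k)) / fact k" for j k
  have "degen_ffact (- lam) x n = (\<Sum>k=0..n. (\<Sum>j=k..n. c j k) * degen_ffact 1 x k)" for x
  proof -
    \<comment> \<open>\<open>n + j\<close> and \<open>n - j\<close> have the same parity.\<close>
    have sign: "(- 1 :: real) ^ n * (- 1) ^ j = (- 1) ^ (n - j)" if "j \<le> n" for j
      using that by (metis power_add minus_one_power_iff even_add even_diff_nat not_less)
    have "degen_ffact (- lam) x n =
        (\<Sum>j=0..n. (- 1) ^ n * (degen_stirling2 lam n j * degen_ffact 1 (- x) j))"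
      by (simp add: degen_ffact_uminus degen_stirling2_expansion[of lam] sum_distrib_left)
    also have "\<dots> = (\<Sum>j=0..n. \<Sum>k=0..j. c j k * degen_ffact 1 x k)"
      by (intro sum.cong refl)
        (auto simp: degen_ffact_1_uminus[of x] c_def sum_distrib_left simp flip: sign
          intro!: sum.cong)
    \<comment> \<open>The triangle \<open>k \<le> j \<le> n\<close> as a restricted square, ready
      for exchanging the sums.\<close>
    also have "\<dots> = (\<Sum>j=0..n. \<Sum>k | k \<in> {0..n} \<and> k \<le> j. c j k * degen_ffact 1 x k)"
      by (intro sum.cong refl) auto
    also have "\<dots> = (\<Sum>k=0..n. \<Sum>j | j \<in> {0..n} \<and> k \<le> j. c j k * degen_ffact 1 x k)"
      by (rule sum.swap_restrict) simp_all
    also have "\<dots> = (\<Sum>k=0..n. \<Sum>j=k..n. c j k * degen_ffact 1 x k)"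
      by (intro sum.cong refl) auto
    finally show ?thesis
      by (simp add: sum_distrib_right)
  qed
  from degen_stirling2_eqI[OF this \<open>n \<ge> \<alpha>\<close>] show ?thesis
    by (simp add: c_def flip: sum_divide_distrib)
qed

end
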